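(* Let $k\in\mathbb{N}$ and let $(\mathbf{A},\mathbf{B})$ be a PCSP template of finite $\sigma$-structures. Then the minions $\mathrm{Pol}(\mathbf{A},\mathbf{B})$ and $\mathrm{Pol}(\mathbf{A}^{\otimes k},\mathbf{B}^{\otimes k})$ are homomorphically equivalent. If, in addition, $\mathbf{A}$ is $k$-enhanced, then $\mathrm{Pol}(\mathbf{A},\mathbf{B})$ and $\mathrm{Pol}(\mathbf{A}^{\otimes k},\mathbf{B}^{\otimes k})$ are isomorphic.
   Context: A $\sigma$-structure $\mathbf{A}$ has domain $A$ and relations $R^{\mathbf{A}}\subseteq A^{\mathrm{ar}(R)}$; homomorphisms preserve all relations coordinatewise. A PCSP template is a pair $(\mathbf{A},\mathbf{B})$ of $\sigma$-structures with a homomorphism $\mathbf{A}\to\mathbf{B}$. A $\sigma$-structure is $k$-enhanced if $\sigma$ contains a $k$-ary symbol $R_k$ with $R_k^{\mathbf{A}}=A^k$. For $\mathbf{a}=(a_1,\dots,a_r)$ and $\mathbf{i}=(i_1,\dots,i_k)\in[r]^k$, $\mathbf{a}_{\mathbf{i}}=(a_{i_1},\dots,a_{i_k})$. Tensor power: $\mathbf{A}^{\otimes k}$ has the same symbols, where $R$ of arity $r$ gets arity $r^k$ with positions indexed by $[r]^k$; domain $A^k$; $R^{\mathbf{A}^{\otimes k}}=\{\mathbf{a}^{\otimes k}:\mathbf{a}\in R^{\mathbf{A}}\}$ with $\mathbf{a}^{\otimes k}$ the family whose $\mathbf{i}$-th entry is $\mathbf{a}_{\mathbf{i}}$. The $L$-th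 power $\mathbf{A}^L$ has domain $A^L$, and a tuple $(t_1,\dots,t_r)$ with $t_j\in A^L$ (indexed by the positions of $R$) is in $R^{\mathbf{A}^L}$ iff for each $\ell\in[L]$ the tuple of $\ell$-th coordinates $(t_1(\ell),\dots,t_r(\ell))$ is in $R^{\mathbf{A}}$. An $L$-ary polymorphism of $(\mathbf{A},\mathbf{B})$ is a homomorphism $\mathbf{A}^L\to\mathbf{B}$. A minion is a disjoint union of sets $\mathscr{M}^{(L)}$, $L\in\mathbb{N}$, with minor maps $(\cdot)_{/\pi}:\mathscr{M}^{(L)}\to\mathscr{M}^{(L')}$ for each $\pi:[L]\to[L']$ such that $M_{/\mathrm{id}}=M$ and $(M_{/\pi})_{/\tilde\pi}=M_{/\tilde\pi\circ\pi}$. $\mathrm{Pol}(\mathbf{A},\mathbf{B})$ is the minion of all polymorphisms with $f_{/\pi}(a_1,\dots,a_{L'})=f(a_{\pi(1)},\dots,a_{\pi(L)})$. A minion homomorphism $\mathscr{M}\to\mathscr{N}$ maps $\mathscr{M}^{(L)}$ into $\mathscr{N}^{(L)}$ and commutes with all minor maps; two minions are homomorphically equivalent if there are minion homomorphisms in both directions, and isomorphic if there is a bijective minion homomorphism whose inverse is a minion homomorphism. *)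

theory Defs
  imports "HOL-Library.FuncSet"
begin

text \<open>
  Tuples indexed by a set I with entries in X are the extensional functions
  from I to X, and [n] is \<^term>\<open>{1..n::nat}\<close>. A symbol carries its set of positions rather than a number:
  [r] for a symbol of arity r, and the set of k-tuples over [r] for the same symbol in the k-th
  tensor power (so that its arity there is r to the power k).
\<close>

record ('s, 'p) rel_signature =
  symbols :: "'s set"
  positions :: "'s \<Rightarrow> 'p set"

record ('s, 'p, 'a) rel_structure =
  domain :: "'a set"
  interp :: "'s \<Rightarrow> ('p \<Rightarrow> 'a) set"

definition signature :: "'s set \<Rightarrow> ('s \<Rightarrow> nat) \<Rightarrow> ('s, nat) rel_signature" where
  "signature S ar = \<lparr>symbols = S, positions = (\<lambda>R. {1..ar R})\<rparr>"

definition is_structure :: "('s, 'p) rel_signature \<Rightarrow> ('s, 'p, 'a) rel_structure \<Rightarrow> bool" where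
  "is_structure \<sigma> A \<longleftrightarrow>
     (\<forall>R\<in>symbols \<sigma>. interp A R \<subseteq> positions \<sigma> R \<rightarrow>\<^sub>E domain A)"

definition homomorphism ::
    "('s, 'p) rel_signature \<Rightarrow> ('s, 'p, 'a) rel_structure \<Rightarrow> ('s, 'p, 'b) rel_structure
      \<Rightarrow> ('a \<Rightarrow> 'b) \<Rightarrow> bool" where
  "homomorphism \<sigma> A B h \<longleftrightarrow>
     h \<in> domain A \<rightarrow>\<^sub>E domain B \<and>
     (\<forall>R\<in>symbols \<sigma>. \<forall>t\<in>interp A R. (\<lambda>p\<in>positions \<sigma> R. h (t p)) \<in> interp B R)"

definition pcsp_template ::
    "('s, 'p) rel_signature \<Rightarrow> ('s, 'p, 'a) rel_structure \<Rightarrow> ('s, 'p, 'b) rel_structure \<Rightarrow> bool"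
  where
  "pcsp_template \<sigma> A B \<longleftrightarrow>
     is_structure \<sigma> A \<and> is_structure \<sigma> B \<and> (\<exists>h. homomorphism \<sigma> A B h)"

definition enhanced ::
    "nat \<Rightarrow> ('s, nat) rel_signature \<Rightarrow> ('s, nat, 'a) rel_structure \<Rightarrow> bool" where
  "enhanced k \<sigma> A \<longleftrightarrow>
     (\<exists>R\<in>symbols \<sigma>. positions \<sigma> R = {1..k} \<and> interp A R = {1..k} \<rightarrow>\<^sub>E domain A)"


subsection \<open>Tensor powers\<close>

definition subtuple :: "nat \<Rightarrow> ('p \<Rightarrow> 'a) \<Rightarrow> (nat \<Rightarrow> 'p) \<Rightarrow> (nat \<Rightarrow> 'a)" where
  "subtuple k a i = (\<lambda>j\<in>{1..k}. a (i j))"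

definition tensor_tuple :: "nat \<Rightarrow> 'p set \<Rightarrow> ('p \<Rightarrow> 'a) \<Rightarrow> ((nat \<Rightarrow> 'p) \<Rightarrow> (nat \<Rightarrow> 'a))" where
  "tensor_tuple k P a = (\<lambda>i\<in>{1..k} \<rightarrow>\<^sub>E P. subtuple k a i)"

definition tensor_signature ::
    "nat \<Rightarrow> ('s, 'p) rel_signature \<Rightarrow> ('s, nat \<Rightarrow> 'p) rel_signature" where
  "tensor_signature k \<sigma> =
     \<lparr>symbols = symbols \<sigma>, positions = (\<lambda>R. {1..k} \<rightarrow>\<^sub>E positions \<sigma> R)\<rparr>"

definition tensor_power ::
    "nat \<Rightarrow> ('s, 'p) rel_signature \<Rightarrow> ('s, 'p, 'a) rel_structure
      \<Rightarrow> ('s, nat \<Rightarrow> 'p, nat \<Rightarrow> 'a) rel_structure" where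
  "tensor_power k \<sigma> A =
     \<lparr>domain = {1..k} \<rightarrow>\<^sub>E domain A,
      interp = (\<lambda>R. tensor_tuple k (positions \<sigma> R) ` interp A R)\<rparr>"


subsection \<open>Minions\<close>

text \<open>
  A minion is given by the family of its sets of L-ary elements; keeping L as an index makes their
  union disjoint. Arities range over the positive integers. The minor of an L-ary element x along
  \<pi> from [L] to [L'] is \<open>minor M L L' \<pi> x\<close>.
\<close>

record 'm minion_data =
  elems :: "nat \<Rightarrow> 'm set"
  minor :: "nat \<Rightarrow> nat \<Rightarrow> (nat \<Rightarrow> nat) \<Rightarrow> 'm \<Rightarrow> 'm"

definition is_minion :: "'m minion_data \<Rightarrow> bool" where
  "is_minion M \<longleftrightarrow>
     (\<forall>L\<ge>1. \<forall>L'\<ge>1. \<forall>\<pi>\<in>{1..L} \<rightarrow>\<^sub>E {1..L'}. minor M L L' \<pi> \<in> elems M L \<rightarrow> elems M L') \<and>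
     (\<forall>L\<ge>1. \<forall>x\<in>elems M L. minor M L L (\<lambda>i\<in>{1..L}. i) x = x) \<and>
     (\<forall>L\<ge>1. \<forall>L'\<ge>1. \<forall>L''\<ge>1.
        \<forall>\<pi>\<in>{1..L} \<rightarrow>\<^sub>E {1..L'}. \<forall>\<rho>\<in>{1..L'} \<rightarrow>\<^sub>E {1..L''}. \<forall>x\<in>elems M L.
          minor M L' L'' \<rho> (minor M L L' \<pi> x) = minor M L L'' (compose {1..L} \<rho> \<pi>) x)"

definition minion_hom ::
    "'m minion_data \<Rightarrow> 'n minion_data \<Rightarrow> (nat \<Rightarrow> 'm \<Rightarrow> 'n) \<Rightarrow> bool" where
  "minion_hom M N \<xi> \<longleftrightarrow>
     is_minion M \<and> is_minion N \<and>
     (\<forall>L\<ge>1. \<xi> L \<in> elems M L \<rightarrow> elems N L) \<and>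
     (\<forall>L\<ge>1. \<forall>L'\<ge>1. \<forall>\<pi>\<in>{1..L} \<rightarrow>\<^sub>E {1..L'}. \<forall>x\<in>elems M L.
        \<xi> L' (minor M L L' \<pi> x) = minor N L L' \<pi> (\<xi> L x))"

definition minion_hom_equivalent :: "'m minion_data \<Rightarrow> 'n minion_data \<Rightarrow> bool" where
  "minion_hom_equivalent M N \<longleftrightarrow> (\<exists>\<xi>. minion_hom M N \<xi>) \<and> (\<exists>\<xi>. minion_hom N M \<xi>)"

definition minion_isomorphic :: "'m minion_data \<Rightarrow> 'n minion_data \<Rightarrow> bool" where
  "minion_isomorphic M N \<longleftrightarrow>
     (\<exists>\<xi>. minion_hom M N \<xi> \<and>
          (\<forall>L\<ge>1. bij_betw (\<xi> L) (elems M L) (elems N L)) \<and>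
          minion_hom N M (\<lambda>L. inv_into (elems M L) (\<xi> L)))"


subsection \<open>Polymorphisms\<close>

definition struct_power ::
    "nat \<Rightarrow> ('s, 'p) rel_signature \<Rightarrow> ('s, 'p, 'a) rel_structure
      \<Rightarrow> ('s, 'p, nat \<Rightarrow> 'a) rel_structure" where
  "struct_power L \<sigma> A =
     \<lparr>domain = {1..L} \<rightarrow>\<^sub>E domain A,
      interp = (\<lambda>R. {t \<in> positions \<sigma> R \<rightarrow>\<^sub>E ({1..L} \<rightarrow>\<^sub>E domain A).
                      \<forall>l\<in>{1..L}. (\<lambda>p\<in>positions \<sigma> R. t p l) \<in> interp A R})\<rparr>"

definition Pol ::
    "('s, 'p) rel_signature \<Rightarrow> ('s, 'p, 'a) rel_structure \<Rightarrow> ('s, 'p, 'b) rel_structure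
      \<Rightarrow> ((nat \<Rightarrow> 'a) \<Rightarrow> 'b) minion_data" where
  "Pol \<sigma> A B =
     \<lparr>elems = (\<lambda>L. {f. homomorphism \<sigma> (struct_power L \<sigma> A) B f}),
      minor = (\<lambda>L L' \<pi> f. \<lambda>a\<in>{1..L'} \<rightarrow>\<^sub>E domain A. f (\<lambda>i\<in>{1..L}. a (\<pi> i)))\<rparr>"


subsection \<open>Well-definedness\<close>

lemma is_structure_tensor_power:
  assumes "is_structure \<sigma> A"
  shows "is_structure (tensor_signature k \<sigma>) (tensor_power k \<sigma> A)"
proof -
  have "tensor_tuple k P a \<in> ({1..k} \<rightarrow>\<^sub>E P) \<rightarrow>\<^sub>E ({1..k} \<rightarrow>\<^sub>E domain A)"
    if "a \<in> P \<rightarrow>\<^sub>E domain A" for P :: "'b set" and a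
    unfolding tensor_tuple_def subtuple_def restrict_PiE_iff
    by (intro ballI PiE_mem[OF that]) (rule PiE_mem)
  then have "tensor_tuple k (positions \<sigma> R) ` interp A R
      \<subseteq> ({1..k} \<rightarrow>\<^sub>E positions \<sigma> R) \<rightarrow>\<^sub>E ({1..k} \<rightarrow>\<^sub>E domain A)" if "R \<in> symbols \<sigma>" for R
    using assms that by (intro image_subsetI) (simp only: is_structure_def subset_eq)
  then show ?thesis
    unfolding is_structure_def tensor_signature_def tensor_power_def
    by (simp only: rel_signature.simps rel_structure.simps ball_simps) (rule ballI)
qed

lemma is_structure_struct_power: "is_structure \<sigma> (struct_power L \<sigma> A)"
  by (auto simp: is_structure_def struct_power_def)

lemma minor_in_Pol:
  assumes f: "f \<in> elems (Pol \<sigma> A B) L" and \<pi>: "\<pi> \<in> {1..L} \<rightarrow>\<^sub>E {1..L'}"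
  shows "minor (Pol \<sigma> A B) L L' \<pi> f \<in> elems (Pol \<sigma> A B) L'"
proof -
  let ?g = "minor (Pol \<sigma> A B) L L' \<pi> f"
  have f1: "f \<in> ({1..L} \<rightarrow>\<^sub>E domain A) \<rightarrow>\<^sub>E domain B"
    and f2: "\<And>R t. R \<in> symbols \<sigma> \<Longrightarrow> t \<in> interp (struct_power L \<sigma> A) R \<Longrightarrow>
      (\<lambda>p\<in>positions \<sigma> R. f (t p)) \<in> interp B R"
    using f by (auto simp: Pol_def homomorphism_def struct_power_def)
  have re: "(\<lambda>i\<in>{1..L}. a (\<pi> i)) \<in> {1..L} \<rightarrow>\<^sub>E domain A" if "a \<in> {1..L'} \<rightarrow>\<^sub>E domain A" for a
    unfolding restrict_PiE_iff by (intro ballI PiE_mem[OF that] PiE_mem[OF \<pi>])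
  have "?g \<in> ({1..L'} \<rightarrow>\<^sub>E domain A) \<rightarrow>\<^sub>E domain B"
    unfolding Pol_def minion_data.simps restrict_PiE_iff by (intro ballI PiE_mem[OF f1] re)
  moreover have "(\<lambda>p\<in>positions \<sigma> R. ?g (t p)) \<in> interp B R"
    if R: "R \<in> symbols \<sigma>" and t: "t \<in> interp (struct_power L' \<sigma> A) R" for R t
  proof -
    have t1: "\<And>p. p \<in> positions \<sigma> R \<Longrightarrow> t p \<in> {1..L'} \<rightarrow>\<^sub>E domain A"
      and t2: "\<And>l. l \<in> {1..L'} \<Longrightarrow> (\<lambda>p\<in>positions \<sigma> R. t p l) \<in> interp A R"
      using t by (auto simp: struct_power_def)
    let ?t = "\<lambda>p\<in>positions \<sigma> R. \<lambda>i\<in>{1..L}. t p (\<pi> i)"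
    have "(\<lambda>p\<in>positions \<sigma> R. ?t p l) \<in> interp A R" if l: "l \<in> {1..L}" for l
    proof -
      have "(\<lambda>p\<in>positions \<sigma> R. ?t p l) = (\<lambda>p\<in>positions \<sigma> R. t p (\<pi> l))"
        using l by (auto simp: fun_eq_iff)
      with t2[of "\<pi> l"] PiE_mem[OF \<pi> l] show ?thesis by simp
    qed
    moreover have "?t \<in> positions \<sigma> R \<rightarrow>\<^sub>E ({1..L} \<rightarrow>\<^sub>E domain A)"
      unfolding restrict_PiE_iff[of _ "positions \<sigma> R"] by (intro ballI re t1)
    ultimately have "?t \<in> interp (struct_power L \<sigma> A) R"
      unfolding struct_power_def by simp
    from f2[OF R this]
    have "(\<lambda>p\<in>positions \<sigma> R. f (?t p)) \<in> interp B R" .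
    moreover have "(\<lambda>p\<in>positions \<sigma> R. f (?t p)) = (\<lambda>p\<in>positions \<sigma> R. ?g (t p))"
      using t1 by (auto simp: fun_eq_iff Pol_def)
    ultimately show ?thesis by simp
  qed
  ultimately show ?thesis
    by (simp add: Pol_def homomorphism_def struct_power_def)
qed

lemma is_minion_Pol: "is_minion (Pol \<sigma> A B)"
  unfolding is_minion_def
proof (intro conjI allI impI ballI funcsetI)
  show "minor (Pol \<sigma> A B) L L' \<pi> f \<in> elems (Pol \<sigma> A B) L'"
    if "\<pi> \<in> {1..L} \<rightarrow>\<^sub>E {1..L'}" "f \<in> elems (Pol \<sigma> A B) L" for L L' \<pi> f
    using minor_in_Pol that by blast
next
  fix L f assume "f \<in> elems (Pol \<sigma> A B) L"
  then have "f \<in> ({1..L} \<rightarrow>\<^sub>E domain A) \<rightarrow>\<^sub>E domain B"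
    by (simp add: Pol_def homomorphism_def struct_power_def)
  then have ext: "f \<in> extensional ({1..L} \<rightarrow>\<^sub>E domain A)"
    by (simp add: PiE_def)
  have "(\<lambda>i\<in>{1..L}. a ((\<lambda>i\<in>{1..L}. i) i)) = a" if "a \<in> {1..L} \<rightarrow>\<^sub>E domain A" for a
    using that by (auto simp: fun_eq_iff PiE_def extensional_def)
  then have "(\<lambda>a\<in>{1..L} \<rightarrow>\<^sub>E domain A. f (\<lambda>i\<in>{1..L}. a ((\<lambda>i\<in>{1..L}. i) i))) =
      (\<lambda>a\<in>{1..L} \<rightarrow>\<^sub>E domain A. f a)"
    by (intro restrict_ext arg_cong[of _ _ f])
  with ext show "minor (Pol \<sigma> A B) L L (\<lambda>i\<in>{1..L}. i) f = f"
    by (simp only: Pol_def minion_data.simps extensional_restrict)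
next
  fix L L' L'' :: nat and \<pi> \<rho> f
  assume \<pi>: "\<pi> \<in> {1..L} \<rightarrow>\<^sub>E {1..L'}" and \<rho>: "\<rho> \<in> {1..L'} \<rightarrow>\<^sub>E {1..L''}"
  have "(\<lambda>i\<in>{1..L'}. a (\<rho> i)) \<in> {1..L'} \<rightarrow>\<^sub>E domain A" if "a \<in> {1..L''} \<rightarrow>\<^sub>E domain A" for a
    unfolding restrict_PiE_iff by (intro ballI PiE_mem[OF that] PiE_mem[OF \<rho>])
  moreover have "(\<lambda>i\<in>{1..L}. (\<lambda>i\<in>{1..L'}. a (\<rho> i)) (\<pi> i)) =
      (\<lambda>i\<in>{1..L}. a (compose {1..L} \<rho> \<pi> i))" if "a \<in> {1..L''} \<rightarrow>\<^sub>E domain A" for a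
    using PiE_mem[OF \<pi>] by (simp add: compose_def fun_eq_iff)
  ultimately show "minor (Pol \<sigma> A B) L' L'' \<rho> (minor (Pol \<sigma> A B) L L' \<pi> f) =
      minor (Pol \<sigma> A B) L L'' (compose {1..L} \<rho> \<pi>) f"
    unfolding Pol_def minion_data.simps
    by (intro restrict_ext) (simp only: restrict_apply')
qed

end

theory Submission
  imports Defs
begin

text \<open>
  A polymorphism f of (A, B) acts coordinatewise on the tensor powers (\<open>coordinatewise\<close>), and a
  polymorphism g of the tensor powers yields one of (A, B) by evaluating g on constant k-tuples and
  reading off one entry (\<open>diagonal\<close>). The second map always undoes the first. If A is k-enhanced,
  then g preserves the tensor power of the full k-ary relation; comparing the entry at the identity
  index tuple with those at the constant index tuples shows that g acts coordinatewise, so the two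
  maps are mutually inverse.
\<close>

section \<open>Row-wise criteria for being a polymorphism\<close>

text \<open>Transposition: a tuple of a relation in the L-th power is a matrix whose rows
  \<open>a 1\<close>, ..., \<open>a L\<close> lie in the relation of \<open>A\<close>, so one may
  quantify over the rows instead. Only values on \<open>{1..L}\<close> enter, hence the family
  \<open>a\<close> need not be extensional.\<close>

lemma in_elems_Pol_iff:
  assumes "is_structure \<sigma> A"
  shows "f \<in> elems (Pol \<sigma> A B) L \<longleftrightarrow>
    f \<in> ({1..L} \<rightarrow>\<^sub>E domain A) \<rightarrow>\<^sub>E domain B \<and>
    (\<forall>R\<in>symbols \<sigma>. \<forall>a\<in>{1..L} \<rightarrow> interp A R.
       (\<lambda>p\<in>positions \<sigma> R. f (\<lambda>l\<in>{1..L}. a l p)) \<in> interp B R)"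
proof -
  have "(\<forall>t\<in>interp (struct_power L \<sigma> A) R. (\<lambda>p\<in>positions \<sigma> R. f (t p)) \<in> interp B R) \<longleftrightarrow>
      (\<forall>a\<in>{1..L} \<rightarrow> interp A R. (\<lambda>p\<in>positions \<sigma> R. f (\<lambda>l\<in>{1..L}. a l p)) \<in> interp B R)"
    if R: "R \<in> symbols \<sigma>" for R
  proof (intro iffI ballI)
    fix a assume f: "\<forall>t\<in>interp (struct_power L \<sigma> A) R. (\<lambda>p\<in>positions \<sigma> R. f (t p)) \<in> interp B R"
      and a: "a \<in> {1..L} \<rightarrow> interp A R"
    have a': "a l \<in> positions \<sigma> R \<rightarrow>\<^sub>E domain A" if "l \<in> {1..L}" for l
      using assms R a that unfolding is_structure_def by blast
    let ?t = "\<lambda>p\<in>positions \<sigma> R. \<lambda>l\<in>{1..L}. a l p"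
    \<comment> \<open>Transposing back recovers \<open>a l\<close> exactly because relation tuples
      of a structure are extensional on the positions.\<close>
    have "(\<lambda>p\<in>positions \<sigma> R. ?t p l) = a l" if "l \<in> {1..L}" for l
      using a'[OF that] that by (auto simp: fun_eq_iff PiE_def extensional_def)
    moreover have "?t \<in> positions \<sigma> R \<rightarrow>\<^sub>E ({1..L} \<rightarrow>\<^sub>E domain A)"
      unfolding restrict_PiE_iff by (intro ballI) (rule PiE_mem[OF a'])
    ultimately have "?t \<in> interp (struct_power L \<sigma> A) R"
      using a by (auto simp: struct_power_def)
    with f have "(\<lambda>p\<in>positions \<sigma> R. f (?t p)) \<in> interp B R"
      by blast
    then show "(\<lambda>p\<in>positions \<sigma> R. f (\<lambda>l\<in>{1..L}. a l p)) \<in> interp B R"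
      by (simp cong: restrict_cong)
  next
    fix t assume f: "\<forall>a\<in>{1..L} \<rightarrow> interp A R.
        (\<lambda>p\<in>positions \<sigma> R. f (\<lambda>l\<in>{1..L}. a l p)) \<in> interp B R"
      and t: "t \<in> interp (struct_power L \<sigma> A) R"
    let ?a = "\<lambda>l. \<lambda>p\<in>positions \<sigma> R. t p l"
    have "?a \<in> {1..L} \<rightarrow> interp A R"
      using t by (auto simp: struct_power_def)
    from bspec[OF f this]
    have "(\<lambda>p\<in>positions \<sigma> R. f (\<lambda>l\<in>{1..L}. ?a l p)) \<in> interp B R" .
    moreover have "(\<lambda>l\<in>{1..L}. ?a l p) = t p" if "p \<in> positions \<sigma> R" for p
    proof -
      have "t p \<in> extensional {1..L}"
        using t that by (auto simp: struct_power_def PiE_def)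
      then show ?thesis
        using that by (auto simp: fun_eq_iff extensional_def)
    qed
    ultimately show "(\<lambda>p\<in>positions \<sigma> R. f (t p)) \<in> interp B R"
      by (simp cong: restrict_cong)
  qed
  moreover have "domain (struct_power L \<sigma> A) = {1..L} \<rightarrow>\<^sub>E domain A"
    by (simp add: struct_power_def)
  ultimately show ?thesis
    by (simp add: Pol_def homomorphism_def)
qed

text \<open>This is the row-wise criterion for the tensor powers, with each row written as the
  tensor power of some \<open>a l\<close>. The point is the order of quantifiers: a single
  \<open>b\<close> in the relation of \<open>B\<close> must serve all index tuples \<open>i\<close>
  at once.\<close>

lemma in_elems_Pol_tensor_iff:
  assumes "is_structure \<sigma> A"
  shows "g \<in> elems (Pol (tensor_signature k \<sigma>) (tensor_power k \<sigma> A) (tensor_power k \<sigma> B)) L \<longleftrightarrow>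
    g \<in> ({1..L} \<rightarrow>\<^sub>E ({1..k} \<rightarrow>\<^sub>E domain A)) \<rightarrow>\<^sub>E ({1..k} \<rightarrow>\<^sub>E domain B) \<and>
    (\<forall>R\<in>symbols \<sigma>. \<forall>a\<in>{1..L} \<rightarrow> interp A R. \<exists>b\<in>interp B R.
       \<forall>i\<in>{1..k} \<rightarrow>\<^sub>E positions \<sigma> R. g (\<lambda>l\<in>{1..L}. subtuple k (a l) i) = subtuple k b i)"
proof -
  let ?P = "\<lambda>R. {1..k} \<rightarrow>\<^sub>E positions \<sigma> R"
  have eq: "(\<lambda>i\<in>?P R. g (\<lambda>l\<in>{1..L}. tensor_tuple k (positions \<sigma> R) (a l) i)) =
        tensor_tuple k (positions \<sigma> R) b \<longleftrightarrow>
      (\<forall>i\<in>?P R. g (\<lambda>l\<in>{1..L}. subtuple k (a l) i) = subtuple k b i)" for R a b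
    by (auto simp: tensor_tuple_def fun_eq_iff[where f = "restrict _ _"] cong: restrict_cong)
  have "(\<forall>c\<in>{1..L} \<rightarrow> tensor_tuple k (positions \<sigma> R) ` interp A R.
        (\<lambda>i\<in>?P R. g (\<lambda>l\<in>{1..L}. c l i)) \<in> tensor_tuple k (positions \<sigma> R) ` interp B R) \<longleftrightarrow>
      (\<forall>a\<in>{1..L} \<rightarrow> interp A R. \<exists>b\<in>interp B R.
        (\<lambda>i\<in>?P R. g (\<lambda>l\<in>{1..L}. tensor_tuple k (positions \<sigma> R) (a l) i)) =
        tensor_tuple k (positions \<sigma> R) b)" (is "?lhs \<longleftrightarrow> ?rhs") for R
  proof (intro iffI ballI)
    fix a assume l: ?lhs and a: "a \<in> {1..L} \<rightarrow> interp A R"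
    have "(\<lambda>l. tensor_tuple k (positions \<sigma> R) (a l))
        \<in> {1..L} \<rightarrow> tensor_tuple k (positions \<sigma> R) ` interp A R"
      using a by auto
    from bspec[OF l this] show "\<exists>b\<in>interp B R.
        (\<lambda>i\<in>?P R. g (\<lambda>l\<in>{1..L}. tensor_tuple k (positions \<sigma> R) (a l) i)) =
        tensor_tuple k (positions \<sigma> R) b"
      by blast
  next
    fix c assume r: ?rhs and "c \<in> {1..L} \<rightarrow> tensor_tuple k (positions \<sigma> R) ` interp A R"
    then have "\<forall>l\<in>{1..L}. \<exists>x. x \<in> interp A R \<and> c l = tensor_tuple k (positions \<sigma> R) x"
      by blast
    \<comment> \<open>One preimage under \<open>tensor_tuple\<close> is chosen for each row; outside
      \<open>{1..L}\<close> the family \<open>a\<close> is arbitrary.\<close>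
    then obtain a where a: "\<forall>l\<in>{1..L}. a l \<in> interp A R \<and> c l = tensor_tuple k (positions \<sigma> R) (a l)"
      by metis
    then have "(\<lambda>l\<in>{1..L}. c l i) = (\<lambda>l\<in>{1..L}. tensor_tuple k (positions \<sigma> R) (a l) i)" for i
      by (intro restrict_ext) simp
    moreover have "a \<in> {1..L} \<rightarrow> interp A R"
      using a by blast
    ultimately show "(\<lambda>i\<in>?P R. g (\<lambda>l\<in>{1..L}. c l i)) \<in> tensor_tuple k (positions \<sigma> R) ` interp B R"
      using bspec[OF r, of a] by auto
  qed
  then show ?thesis
    unfolding in_elems_Pol_iff[OF is_structure_tensor_power[OF assms]]
    by (simp add: tensor_signature_def tensor_power_def eq del: One_nat_def)
qed

section \<open>The two maps between the polymorphism sets\<close>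

text \<open>The argument \<open>x\<close> is an L by k matrix with rows \<open>x l\<close> in the
  tensor domain, and \<open>f\<close> is applied to each of its k columns. The restrictions make the
  result extensional, as elements of \<open>Pol\<close> are.\<close>

definition coordinatewise ::
    "nat \<Rightarrow> 'a set \<Rightarrow> nat \<Rightarrow> ((nat \<Rightarrow> 'a) \<Rightarrow> 'b) \<Rightarrow> (nat \<Rightarrow> nat \<Rightarrow> 'a) \<Rightarrow> nat \<Rightarrow> 'b" where
  "coordinatewise k X L f =
     (\<lambda>x\<in>{1..L} \<rightarrow>\<^sub>E ({1..k} \<rightarrow>\<^sub>E X). \<lambda>j\<in>{1..k}. f (\<lambda>l\<in>{1..L}. x l j))"

text \<open>Entry 1 is a choice of coordinate that exists for k \<ge> 1. When the argument is a
  column of a family of relation tuples, a polymorphism \<open>g\<close> returns a constant k-tuple,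
  so every entry would give the same value.\<close>

definition diagonal ::
    "nat \<Rightarrow> 'a set \<Rightarrow> nat \<Rightarrow> ((nat \<Rightarrow> nat \<Rightarrow> 'a) \<Rightarrow> nat \<Rightarrow> 'b) \<Rightarrow> (nat \<Rightarrow> 'a) \<Rightarrow> 'b" where
  "diagonal k X L g = (\<lambda>x\<in>{1..L} \<rightarrow>\<^sub>E X. g (\<lambda>l\<in>{1..L}. \<lambda>j\<in>{1..k}. x l) 1)"

lemma column_in_PiE:
  assumes "x \<in> I \<rightarrow>\<^sub>E (J \<rightarrow>\<^sub>E X)" "j \<in> J"
  shows "(\<lambda>l\<in>I. x l j) \<in> I \<rightarrow>\<^sub>E X"
  unfolding restrict_PiE_iff by (intro ballI PiE_mem[OF PiE_mem[OF assms(1)] assms(2)])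

lemma constant_rows_in_PiE:
  assumes "x \<in> I \<rightarrow>\<^sub>E X"
  shows "(\<lambda>l\<in>I. \<lambda>j\<in>J. x l) \<in> I \<rightarrow>\<^sub>E (J \<rightarrow>\<^sub>E X)"
  unfolding restrict_PiE_iff by (intro ballI PiE_mem[OF assms])

lemma reindex_in_PiE:
  assumes "x \<in> I \<rightarrow>\<^sub>E X" "\<pi> \<in> J \<rightarrow>\<^sub>E I"
  shows "(\<lambda>i\<in>J. x (\<pi> i)) \<in> J \<rightarrow>\<^sub>E X"
  unfolding restrict_PiE_iff by (intro ballI PiE_mem[OF assms(1)] PiE_mem[OF assms(2)])

text \<open>Let \<open>b\<close> be the relation tuple that \<open>f\<close> produces from the rows
  \<open>a l\<close>. Selecting entries by an index tuple \<open>i\<close> makes column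
  \<open>j\<close> of the new matrix equal to column \<open>i j\<close> of the old one, so
  \<open>f\<close> yields \<open>b (i j)\<close> there. Thus the same \<open>b\<close> works for
  every \<open>i\<close>.\<close>

lemma coordinatewise_in_Pol:
  assumes A: "is_structure \<sigma> A" and f: "f \<in> elems (Pol \<sigma> A B) L"
  shows "coordinatewise k (domain A) L f
    \<in> elems (Pol (tensor_signature k \<sigma>) (tensor_power k \<sigma> A) (tensor_power k \<sigma> B)) L"
  unfolding in_elems_Pol_tensor_iff[OF A]
proof (intro conjI ballI)
  have f1: "f \<in> ({1..L} \<rightarrow>\<^sub>E domain A) \<rightarrow>\<^sub>E domain B"
    and f2: "\<And>R a. R \<in> symbols \<sigma> \<Longrightarrow> a \<in> {1..L} \<rightarrow> interp A R \<Longrightarrow>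
      (\<lambda>p\<in>positions \<sigma> R. f (\<lambda>l\<in>{1..L}. a l p)) \<in> interp B R"
    using f by (simp_all add: in_elems_Pol_iff[OF A])
  show "coordinatewise k (domain A) L f
      \<in> ({1..L} \<rightarrow>\<^sub>E ({1..k} \<rightarrow>\<^sub>E domain A)) \<rightarrow>\<^sub>E ({1..k} \<rightarrow>\<^sub>E domain B)"
    unfolding coordinatewise_def restrict_PiE_iff by (intro ballI PiE_mem[OF f1] column_in_PiE)
  fix R a assume R: "R \<in> symbols \<sigma>" and a: "a \<in> {1..L} \<rightarrow> interp A R"
  let ?b = "\<lambda>p\<in>positions \<sigma> R. f (\<lambda>l\<in>{1..L}. a l p)"
  have "coordinatewise k (domain A) L f (\<lambda>l\<in>{1..L}. subtuple k (a l) i) = subtuple k ?b i"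
    if i: "i \<in> {1..k} \<rightarrow>\<^sub>E positions \<sigma> R" for i
  proof -
    have a': "a l \<in> positions \<sigma> R \<rightarrow>\<^sub>E domain A" if "l \<in> {1..L}" for l
      using A R a that unfolding is_structure_def by blast
    have "(\<lambda>l\<in>{1..L}. subtuple k (a l) i) \<in> {1..L} \<rightarrow>\<^sub>E ({1..k} \<rightarrow>\<^sub>E domain A)"
      unfolding subtuple_def restrict_PiE_iff by (intro ballI) (rule PiE_mem[OF a' PiE_mem[OF i]])
    then show ?thesis
      using PiE_mem[OF i] by (auto simp: coordinatewise_def subtuple_def fun_eq_iff cong: restrict_cong)
  qed
  with f2[OF R a] show "\<exists>b\<in>interp B R. \<forall>i\<in>{1..k} \<rightarrow>\<^sub>E positions \<sigma> R.
      coordinatewise k (domain A) L f (\<lambda>l\<in>{1..L}. subtuple k (a l) i) = subtuple k b i"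
    by blast
qed

lemma subtuple_constant: "subtuple k a (\<lambda>j\<in>{1..k}. p) = (\<lambda>j\<in>{1..k}. a p)"
  by (auto simp: subtuple_def)

text \<open>At the index tuple constantly \<open>p\<close>, the selected rows are constant and
  \<open>g\<close> returns the constant tuple with value \<open>b p\<close>. Reading off an entry
  for each position \<open>p\<close> therefore reassembles \<open>b\<close>.\<close>

lemma diagonal_in_Pol:
  assumes A: "is_structure \<sigma> A" and B: "is_structure \<sigma> B" and k: "k \<ge> 1"
    and g: "g \<in> elems (Pol (tensor_signature k \<sigma>) (tensor_power k \<sigma> A) (tensor_power k \<sigma> B)) L"
  shows "diagonal k (domain A) L g \<in> elems (Pol \<sigma> A B) L"
  unfolding in_elems_Pol_iff[OF A]
proof (intro conjI ballI)
  have g1: "g \<in> ({1..L} \<rightarrow>\<^sub>E ({1..k} \<rightarrow>\<^sub>E domain A)) \<rightarrow>\<^sub>E ({1..k} \<rightarrow>\<^sub>E domain B)"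
    and g2: "\<And>R a. R \<in> symbols \<sigma> \<Longrightarrow> a \<in> {1..L} \<rightarrow> interp A R \<Longrightarrow> \<exists>b\<in>interp B R.
      \<forall>i\<in>{1..k} \<rightarrow>\<^sub>E positions \<sigma> R. g (\<lambda>l\<in>{1..L}. subtuple k (a l) i) = subtuple k b i"
    using g by (simp_all add: in_elems_Pol_tensor_iff[OF A])
  have "1 \<in> {1..k}"
    using k by simp
  then show "diagonal k (domain A) L g \<in> ({1..L} \<rightarrow>\<^sub>E domain A) \<rightarrow>\<^sub>E domain B"
    unfolding diagonal_def restrict_PiE_iff
    by (intro ballI PiE_mem[OF PiE_mem[OF g1]] constant_rows_in_PiE)
  fix R a assume R: "R \<in> symbols \<sigma>" and a: "a \<in> {1..L} \<rightarrow> interp A R"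
  from g2[OF R a] obtain b where b: "b \<in> interp B R"
    and gb: "\<And>i. i \<in> {1..k} \<rightarrow>\<^sub>E positions \<sigma> R \<Longrightarrow>
      g (\<lambda>l\<in>{1..L}. subtuple k (a l) i) = subtuple k b i"
    by blast
  have a': "a l \<in> positions \<sigma> R \<rightarrow>\<^sub>E domain A" if "l \<in> {1..L}" for l
    using A R a that unfolding is_structure_def by blast
  have "diagonal k (domain A) L g (\<lambda>l\<in>{1..L}. a l p) = b p" if p: "p \<in> positions \<sigma> R" for p
  proof -
    have "(\<lambda>l\<in>{1..L}. a l p) \<in> {1..L} \<rightarrow>\<^sub>E domain A"
      unfolding restrict_PiE_iff by (intro ballI PiE_mem[OF a' p])
    then have "diagonal k (domain A) L g (\<lambda>l\<in>{1..L}. a l p) =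
        g (\<lambda>l\<in>{1..L}. \<lambda>j\<in>{1..k}. a l p) 1"
      by (simp add: diagonal_def cong: restrict_cong)
    also have "\<dots> = g (\<lambda>l\<in>{1..L}. subtuple k (a l) (\<lambda>j\<in>{1..k}. p)) 1"
      by (simp only: subtuple_constant)
    also have "\<dots> = b p"
      using gb[of "\<lambda>j\<in>{1..k}. p"] p k by (simp add: subtuple_def)
    finally show ?thesis .
  qed
  \<comment> \<open>Agreement at the positions becomes equality with \<open>b\<close> since tuples
    of \<open>B\<close> are extensional there.\<close>
  moreover have "b \<in> extensional (positions \<sigma> R)"
    using B R b unfolding is_structure_def PiE_def by blast
  ultimately have "(\<lambda>p\<in>positions \<sigma> R. diagonal k (domain A) L g (\<lambda>l\<in>{1..L}. a l p)) = b"
    by (auto simp: fun_eq_iff extensional_def)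
  with b show "(\<lambda>p\<in>positions \<sigma> R. diagonal k (domain A) L g (\<lambda>l\<in>{1..L}. a l p)) \<in> interp B R"
    by simp
qed

section \<open>The compositions of the two maps\<close>

text \<open>In the matrix with constant rows \<open>x l\<close>, every column is \<open>x\<close>
  itself, so the coordinatewise image is constantly \<open>f x\<close>.\<close>

lemma diagonal_coordinatewise:
  assumes A: "is_structure \<sigma> A" and k: "k \<ge> 1" and f: "f \<in> elems (Pol \<sigma> A B) L"
  shows "diagonal k (domain A) L (coordinatewise k (domain A) L f) = f"
proof -
  have "diagonal k (domain A) L (coordinatewise k (domain A) L f) x = f x"
    if x: "x \<in> {1..L} \<rightarrow>\<^sub>E domain A" for x
  proof -
    have "(\<lambda>l\<in>{1..L}. x l) = x"
      using x by (simp add: PiE_def extensional_restrict)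
    then show ?thesis
      using x constant_rows_in_PiE[OF x, of "{1..k}"] k
      by (simp add: diagonal_def coordinatewise_def cong: restrict_cong)
  qed
  moreover have "f \<in> extensional ({1..L} \<rightarrow>\<^sub>E domain A)"
    using f by (simp add: in_elems_Pol_iff[OF A] PiE_def)
  ultimately show ?thesis
    by (intro extensionalityI[of _ "{1..L} \<rightarrow>\<^sub>E domain A"]) (simp_all add: diagonal_def)
qed

lemma coordinatewise_diagonal:
  assumes A: "is_structure \<sigma> A" and B: "is_structure \<sigma> B" and k: "k \<ge> 1"
    and e: "enhanced k \<sigma> A"
    and g: "g \<in> elems (Pol (tensor_signature k \<sigma>) (tensor_power k \<sigma> A) (tensor_power k \<sigma> B)) L"
  shows "coordinatewise k (domain A) L (diagonal k (domain A) L g) = g"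
proof -
  have g1: "g \<in> ({1..L} \<rightarrow>\<^sub>E ({1..k} \<rightarrow>\<^sub>E domain A)) \<rightarrow>\<^sub>E ({1..k} \<rightarrow>\<^sub>E domain B)"
    and g2: "\<And>R a. R \<in> symbols \<sigma> \<Longrightarrow> a \<in> {1..L} \<rightarrow> interp A R \<Longrightarrow> \<exists>b\<in>interp B R.
      \<forall>i\<in>{1..k} \<rightarrow>\<^sub>E positions \<sigma> R. g (\<lambda>l\<in>{1..L}. subtuple k (a l) i) = subtuple k b i"
    using g by (simp_all add: in_elems_Pol_tensor_iff[OF A])
  obtain R where R: "R \<in> symbols \<sigma>" and pos: "positions \<sigma> R = {1..k}"
    and full: "interp A R = {1..k} \<rightarrow>\<^sub>E domain A"
    using e unfolding enhanced_def by blast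
  have "coordinatewise k (domain A) L (diagonal k (domain A) L g) x = g x"
    if x: "x \<in> {1..L} \<rightarrow>\<^sub>E ({1..k} \<rightarrow>\<^sub>E domain A)" for x
  proof -
    \<comment> \<open>Since the relation is full, the rows of an arbitrary matrix \<open>x\<close>
      qualify as relation tuples. The resulting \<open>b\<close> depends on
      \<open>x\<close>.\<close>
    have "x \<in> {1..L} \<rightarrow> interp A R"
      using x by (simp add: full PiE_def)
    from g2[OF R this] obtain b
      where gb: "\<And>i. i \<in> {1..k} \<rightarrow>\<^sub>E {1..k} \<Longrightarrow>
        g (\<lambda>l\<in>{1..L}. subtuple k (x l) i) = subtuple k b i"
      unfolding pos by blast
    \<comment> \<open>The positions of \<open>R\<close> are \<open>{1..k}\<close>, so the identity
      is itself an index tuple. It selects all of \<open>x\<close>, which identifies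
      \<open>b\<close> with \<open>g x\<close>.\<close>
    have "subtuple k (x l) (\<lambda>j\<in>{1..k}. j) = x l" if "l \<in> {1..L}" for l
      using PiE_mem[OF x that] by (auto simp: subtuple_def fun_eq_iff PiE_def extensional_def)
    then have "(\<lambda>l\<in>{1..L}. subtuple k (x l) (\<lambda>j\<in>{1..k}. j)) = (\<lambda>l\<in>{1..L}. x l)"
      by (intro restrict_ext)
    also have "\<dots> = x"
      using x by (simp add: PiE_def extensional_restrict)
    finally have gx: "g x = (\<lambda>j\<in>{1..k}. b j)"
      using gb[of "\<lambda>j\<in>{1..k}. j"] by (simp add: subtuple_def cong: restrict_cong)
    \<comment> \<open>The index tuple constantly \<open>j\<close> repeats column \<open>j\<close>,
      so this second use of the same \<open>b\<close> ties the diagonal value to entry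
      \<open>j\<close> of \<open>g x\<close>.\<close>
    have "diagonal k (domain A) L g (\<lambda>l\<in>{1..L}. x l j) = b j" if j: "j \<in> {1..k}" for j
    proof -
      have "diagonal k (domain A) L g (\<lambda>l\<in>{1..L}. x l j) =
          g (\<lambda>l\<in>{1..L}. \<lambda>i\<in>{1..k}. x l j) 1"
        using column_in_PiE[OF x j] by (simp add: diagonal_def cong: restrict_cong)
      also have "\<dots> = g (\<lambda>l\<in>{1..L}. subtuple k (x l) (\<lambda>i\<in>{1..k}. j)) 1"
        by (simp only: subtuple_constant)
      also have "\<dots> = b j"
        using gb[of "\<lambda>i\<in>{1..k}. j"] j k by (simp add: subtuple_def)
      finally show ?thesis .
    qed
    then show ?thesis
      using x by (simp add: coordinatewise_def gx cong: restrict_cong)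
  qed
  moreover have "g \<in> extensional ({1..L} \<rightarrow>\<^sub>E ({1..k} \<rightarrow>\<^sub>E domain A))"
    using g1 by (simp add: PiE_def)
  ultimately show ?thesis
    by (intro extensionalityI[of _ "{1..L} \<rightarrow>\<^sub>E ({1..k} \<rightarrow>\<^sub>E domain A)"])
      (simp_all add: coordinatewise_def)
qed

section \<open>Compatibility with minors\<close>

text \<open>A minor reindexes the rows of the matrix while \<open>coordinatewise\<close> works
  column by column, and the two operations commute.\<close>

lemma minion_hom_coordinatewise:
  assumes A: "is_structure \<sigma> A"
  shows "minion_hom (Pol \<sigma> A B)
    (Pol (tensor_signature k \<sigma>) (tensor_power k \<sigma> A) (tensor_power k \<sigma> B))
    (coordinatewise k (domain A))"
  unfolding minion_hom_def
proof (intro conjI allI impI ballI funcsetI is_minion_Pol)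
  fix L L' :: nat and \<pi> f assume \<pi>: "\<pi> \<in> {1..L} \<rightarrow>\<^sub>E {1..L'}"
  have eq: "minor (Pol \<sigma> A B) L L' \<pi> f (\<lambda>l\<in>{1..L'}. x l j) =
      f (\<lambda>l\<in>{1..L}. (\<lambda>i\<in>{1..L}. x (\<pi> i)) l j)"
    if "x \<in> {1..L'} \<rightarrow>\<^sub>E ({1..k} \<rightarrow>\<^sub>E domain A)" "j \<in> {1..k}" for x j
    using column_in_PiE[OF that] PiE_mem[OF \<pi>] by (simp add: Pol_def cong: restrict_cong)
  show "coordinatewise k (domain A) L' (minor (Pol \<sigma> A B) L L' \<pi> f) =
      minor (Pol (tensor_signature k \<sigma>) (tensor_power k \<sigma> A) (tensor_power k \<sigma> B)) L L' \<pi>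
        (coordinatewise k (domain A) L f)"
    \<comment> \<open>Instantiating \<open>Pol_def\<close> at the tensor signature keeps the minor
      of \<open>f\<close> folded, as \<open>eq\<close> expects.\<close>
    unfolding coordinatewise_def Pol_def[of "tensor_signature k \<sigma>"] tensor_power_def
      minion_data.simps rel_structure.simps
    by (intro restrict_ext)
      (simp only: restrict_apply' reindex_in_PiE[OF _ \<pi>], intro restrict_ext eq)
qed (rule coordinatewise_in_Pol[OF A])

text \<open>Spreading arguments into constant rows commutes with reindexing them along
  \<open>\<pi>\<close>.\<close>

lemma minion_hom_diagonal:
  assumes A: "is_structure \<sigma> A" and B: "is_structure \<sigma> B" and k: "k \<ge> 1"
  shows "minion_hom (Pol (tensor_signature k \<sigma>) (tensor_power k \<sigma> A) (tensor_power k \<sigma> B))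
    (Pol \<sigma> A B) (diagonal k (domain A))"
  unfolding minion_hom_def
proof (intro conjI allI impI ballI funcsetI is_minion_Pol)
  let ?M = "Pol (tensor_signature k \<sigma>) (tensor_power k \<sigma> A) (tensor_power k \<sigma> B)"
  fix L L' :: nat and \<pi> g assume \<pi>: "\<pi> \<in> {1..L} \<rightarrow>\<^sub>E {1..L'}"
  have "minor ?M L L' \<pi> g (\<lambda>l\<in>{1..L'}. \<lambda>j\<in>{1..k}. x l) =
      g (\<lambda>l\<in>{1..L}. \<lambda>j\<in>{1..k}. (\<lambda>i\<in>{1..L}. x (\<pi> i)) l)"
    if "x \<in> {1..L'} \<rightarrow>\<^sub>E domain A" for x
    using constant_rows_in_PiE[OF that, of "{1..k}"] PiE_mem[OF \<pi>]
    by (simp add: Pol_def tensor_power_def cong: restrict_cong)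
  then show "diagonal k (domain A) L' (minor ?M L L' \<pi> g) =
      minor (Pol \<sigma> A B) L L' \<pi> (diagonal k (domain A) L g)"
    unfolding diagonal_def Pol_def[of \<sigma>] minion_data.simps
    by (intro restrict_ext) (simp only: restrict_apply' reindex_in_PiE[OF _ \<pi>])
qed (rule diagonal_in_Pol[OF A B k])

section \<open>From mutually inverse homomorphisms to an isomorphism\<close>

text \<open>The definition of isomorphism speaks of \<open>inv_into\<close>. On elements of
  \<open>N\<close> it coincides with \<open>\<zeta>\<close>, so the homomorphism property carries
  over.\<close>

lemma minion_isomorphicI:
  assumes \<xi>: "minion_hom M N \<xi>" and \<zeta>: "minion_hom N M \<zeta>"
    and l: "\<And>L x. L \<ge> 1 \<Longrightarrow> x \<in> elems M L \<Longrightarrow> \<zeta> L (\<xi> L x) = x"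
    and r: "\<And>L y. L \<ge> 1 \<Longrightarrow> y \<in> elems N L \<Longrightarrow> \<xi> L (\<zeta> L y) = y"
  shows "minion_isomorphic M N"
proof -
  have \<xi>_in: "\<xi> L \<in> elems M L \<rightarrow> elems N L" and \<zeta>_in: "\<zeta> L \<in> elems N L \<rightarrow> elems M L"
    if "L \<ge> 1" for L
    using \<xi> \<zeta> that by (auto simp: minion_hom_def)
  have bij: "bij_betw (\<xi> L) (elems M L) (elems N L)" if "L \<ge> 1" for L
    using \<xi>_in[OF that] \<zeta>_in[OF that] l[OF that] r[OF that]
    by (intro bij_betwI[where g = "\<zeta> L"]) auto
  have inv: "inv_into (elems M L) (\<xi> L) y = \<zeta> L y" if "L \<ge> 1" "y \<in> elems N L" for L y
    using bij[OF that(1)] \<zeta>_in[OF that(1)] r[OF that] that(2)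
    by (intro inv_into_f_eq) (auto simp: bij_betw_def)
  \<comment> \<open>Closure of \<open>N\<close> under minors allows \<open>inv_into\<close> to be
    replaced by \<open>\<zeta>\<close> at a minor of \<open>y\<close> too.\<close>
  have N: "minor N L L' \<pi> y \<in> elems N L'"
    if "L \<ge> 1" "L' \<ge> 1" "\<pi> \<in> {1..L} \<rightarrow>\<^sub>E {1..L'}" "y \<in> elems N L" for L L' \<pi> y
  proof -
    have "is_minion N"
      using \<zeta> by (simp add: minion_hom_def)
    then have "minor N L L' \<pi> \<in> elems N L \<rightarrow> elems N L'"
      using that by (simp add: is_minion_def)
    then show ?thesis
      using that by (simp add: Pi_iff)
  qed
  have "minion_hom N M (\<lambda>L. inv_into (elems M L) (\<xi> L))"
    using \<zeta> N unfolding minion_hom_def by (simp add: inv Pi_iff)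
  with \<xi> bij show ?thesis
    unfolding minion_isomorphic_def by blast
qed

theorem theorem7p3:
  fixes S :: "'s set" and ar :: "'s \<Rightarrow> nat" and \<sigma> :: "('s, nat) rel_signature"
    and A :: "('s, nat, 'a) rel_structure" and B :: "('s, nat, 'b) rel_structure"
    and k :: nat
  assumes "k \<ge> 1"
    and "\<sigma> = signature S ar"
    and "pcsp_template \<sigma> A B"
    and "finite (domain A)" and "finite (domain B)"
  shows "minion_hom_equivalent (Pol \<sigma> A B)
           (Pol (tensor_signature k \<sigma>) (tensor_power k \<sigma> A) (tensor_power k \<sigma> B)) \<and>
         (enhanced k \<sigma> A \<longrightarrow>
          minion_isomorphic (Pol \<sigma> A B)
            (Pol (tensor_signature k \<sigma>) (tensor_power k \<sigma> A) (tensor_power k \<sigma> B)))"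
proof -
  have A: "is_structure \<sigma> A" and B: "is_structure \<sigma> B"
    using assms(3) by (simp_all add: pcsp_template_def)
  note \<xi> = minion_hom_coordinatewise[OF A] and \<zeta> = minion_hom_diagonal[OF A B assms(1)]
  show ?thesis
    unfolding minion_hom_equivalent_def
    \<comment> \<open>The pair of homomorphisms settles equivalence; the enhancement hypothesis
      enters through \<open>coordinatewise_diagonal\<close>.\<close>
    using \<xi> \<zeta> minion_isomorphicI[OF \<xi> \<zeta>]
      diagonal_coordinatewise[OF A assms(1)] coordinatewise_diagonal[OF A B assms(1)]
    by blast
qed

end
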